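(* Let $\beta\in\mathbb{R}^h_{++}$ and $\gamma\in\mathbb{R}^k_{++}$ satisfy $\max(\lVert\beta\rVert_1,\lVert\gamma\rVert_1)\le 1$, and let $\mathcal{S}_{\mathrm{st}}=\{(u,v)\in\mathbb{R}_+^{h+k}: \psi_\beta(u)-\psi_\gamma(v)\le 0\}$, with $u\in\mathbb{R}^h_+$, $v\in\mathbb{R}^k_+$. For any $\tilde v\in\mathbb{R}^k_{++}$, the set $$\mathcal{C}:=\{(u,v)\in\mathbb{R}^h_+\times\mathbb{R}^k: \psi_\beta(u)-\Xi^{\psi_\gamma}_{\tilde v}(v)\ge 0\}$$ is $\mathcal{S}_{\mathrm{st}}$-free. If moreover $\max(\lVert\beta\rVert_1,\lVert\gamma\rVert_1)=1$, then $\mathcal{C}$ is a maximal $\mathcal{S}_{\mathrm{st}}$-free set in $\mathcal{G}=\mathbb{R}_+^{h+k}$.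
   Context: $\mathbb{R}_+$ and $\mathbb{R}_{++}$ are the nonnegative and positive reals. For an exponent vector $\alpha$, $\psi_\alpha(x)=x^\alpha=\prod_j x_j^{\alpha_j}$ (an empty product is $1$; $h+k\ge 1$). For differentiable $f$, $\Xi^{f}_{\tilde x}(x):=f(\tilde x)+\nabla f(\tilde x)\cdot(x-\tilde x)$ (here the affine function $\Xi^{\psi_\gamma}_{\tilde v}$ is considered on all of $\mathbb{R}^k$). Given $\mathcal{S}\subsetneq\mathbb{R}^p$, a closed set $\mathcal{C}\subseteq\mathbb{R}^p$ is $\mathcal{S}$-free if $\mathcal{C}$ is convex and $\mathrm{int}(\mathcal{C})\cap\mathcal{S}=\varnothing$. Given a closed convex set $\mathcal{G}\subseteq\mathbb{R}^p$ with $\mathcal{S}\subsetneq\mathcal{G}$, an $\mathcal{S}$-free set $\mathcal{C}$ is maximal in $\mathcal{G}$ if there is no other $\mathcal{S}$-free set $\mathcal{C}'$ such that $\mathcal{C}\cap\mathcal{G}\subsetneq\mathcal{C}'\cap\mathcal{G}$. *)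

theory Defs
  imports "HOL-Analysis.Analysis"
begin

text \<open>
  \<open>\<real>\<^sup>h \<times> \<real>\<^sup>k\<close> is rendered as \<open>real ^ 'n\<close> together with a partition of the index type into
  \<open>H\<close> (the \<open>h\<close> coordinates of \<open>u\<close>) and \<open>K\<close> (the \<open>k\<close> coordinates of \<open>v\<close>). In contrast to
  \<open>(real ^ 'h) \<times> (real ^ 'k)\<close> this admits \<open>h = 0\<close> and \<open>k = 0\<close>, while \<open>h + k \<ge> 1\<close> holds because
  types are nonempty. A vector of \<open>\<real>\<^sup>h\<close> (or \<open>\<real>\<^sup>k\<close>) is a vector of \<open>real ^ 'n\<close> of which only the
  components in \<open>H\<close> (or \<open>K\<close>) are constrained and used.
\<close>

definition orthant_on :: "'n::finite set \<Rightarrow> (real ^ 'n) set" where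
  "orthant_on I = {x. \<forall>j\<in>I. 0 \<le> x $ j}"

definition pos_orthant_on :: "'n::finite set \<Rightarrow> (real ^ 'n) set" where
  "pos_orthant_on I = {x. \<forall>j\<in>I. 0 < x $ j}"

definition l1_norm_on :: "'n::finite set \<Rightarrow> real ^ 'n \<Rightarrow> real" where
  "l1_norm_on I x = (\<Sum>j\<in>I. \<bar>x $ j\<bar>)"

text \<open>Only evaluated where the components in \<open>I\<close> are nonnegative and the exponents are positive;
  there \<open>0 powr a = 0\<close> agrees with the usual convention.\<close>

definition monomial_on :: "'n::finite set \<Rightarrow> real ^ 'n \<Rightarrow> real ^ 'n \<Rightarrow> real" where
  "monomial_on I \<alpha> x = (\<Prod>j\<in>I. (x $ j) powr (\<alpha> $ j))"

definition gradient :: "('a::real_inner \<Rightarrow> real) \<Rightarrow> 'a \<Rightarrow> 'a" where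
  "gradient f x = (THE D. GDERIV f x :> D)"

text \<open>As a function on \<open>real ^ 'n\<close>, \<open>monomial_on K \<gamma>\<close> has zero partial derivatives outside \<open>K\<close>, so
  its linearization below is the one of the monomial on \<open>\<real>\<^sup>k\<close>, applied to the \<open>v\<close>-part.\<close>

definition linearization :: "('a::real_inner \<Rightarrow> real) \<Rightarrow> 'a \<Rightarrow> 'a \<Rightarrow> real" where
  "linearization f x0 x = f x0 + gradient f x0 \<bullet> (x - x0)"

definition S_free :: "'a::euclidean_space set \<Rightarrow> 'a set \<Rightarrow> bool" where
  "S_free S C \<longleftrightarrow> S \<subset> UNIV \<and> closed C \<and> convex C \<and> interior C \<inter> S = {}"

definition maximal_S_free_in :: "'a::euclidean_space set \<Rightarrow> 'a set \<Rightarrow> 'a set \<Rightarrow> bool" where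
  "maximal_S_free_in S G C \<longleftrightarrow>
     closed G \<and> convex G \<and> S \<subset> G \<and> S_free S C \<and>
     \<not> (\<exists>C'. S_free S C' \<and> C \<inter> G \<subset> C' \<inter> G)"

definition S_st :: "'n::finite set \<Rightarrow> 'n set \<Rightarrow> real ^ 'n \<Rightarrow> real ^ 'n \<Rightarrow> (real ^ 'n) set" where
  "S_st H K \<beta> \<gamma> = {x \<in> orthant_on UNIV. monomial_on H \<beta> x - monomial_on K \<gamma> x \<le> 0}"

definition C_st ::
  "'n::finite set \<Rightarrow> 'n set \<Rightarrow> real ^ 'n \<Rightarrow> real ^ 'n \<Rightarrow> real ^ 'n \<Rightarrow> (real ^ 'n) set" where
  "C_st H K \<beta> \<gamma> vt =
     {x \<in> orthant_on H. monomial_on H \<beta> x - linearization (monomial_on K \<gamma>) vt x \<ge> 0}"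

end

theory Submission
  imports Defs
begin

text \<open>
  Weighted AM-GM says that a monomial with positive exponents of sum at most 1 lies below each of its
  linearizations; this gives concavity, hence convexity of \<open>\<C>\<close>, and shows that the defining
  function \<open>g = \<psi>\<^sub>\<beta> - \<Xi>\<close> is nonpositive on \<open>\<S>\<close>. An interior point of \<open>\<C>\<close> in \<open>\<S>\<close> would be
  a zero of \<open>g\<close>, which is impossible as \<open>g\<close> strictly decreases in the direction \<open>(u, v) = (-1, 1)\<close>.

  For maximality, let \<open>x \<in> \<G>\<close> with \<open>g x < 0\<close>. Since one of the monomials is homogeneous of degree
  1, there is a positive point \<open>p \<in> \<S>\<close> with \<open>g p = 0\<close> at which the tangent hyperplane of \<open>\<C>\<close>
  has \<open>x\<close> strictly outside. Then \<open>g > 0\<close> slightly beyond \<open>p\<close> on the ray from \<open>x\<close> through \<open>p\<close>, so \<open>p\<close>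
  is interior to every convex set that contains \<open>x\<close> and \<open>\<C> \<inter> \<G>\<close>.
\<close>

subsection \<open>Monomials and their linearizations\<close>

lemma pos_orthant_on_subset_orthant_on: "pos_orthant_on I \<subseteq> orthant_on I"
  by (auto simp: pos_orthant_on_def orthant_on_def intro: less_imp_le)

lemma closed_orthant_on: "closed (orthant_on I)"
proof -
  have "orthant_on I = (\<Inter>j\<in>I. {x. 0 \<le> x $ j})"
    by (auto simp: orthant_on_def)
  then show ?thesis
    by (simp only:) (intro closed_INT ballI closed_Collect_le continuous_intros)
qed

lemma convex_orthant_on: "convex (orthant_on I)"
  by (auto simp: orthant_on_def convex_def)

lemma open_pos_orthant_on: "open (pos_orthant_on I)"
proof -
  have "pos_orthant_on I = (\<Inter>j\<in>I. {x. 0 < x $ j})"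
    by (auto simp: pos_orthant_on_def)
  then show ?thesis
    by (simp only:) (intro open_INT ballI finite open_Collect_less continuous_intros)
qed

lemma l1_norm_on_pos_orthant: "\<alpha> \<in> pos_orthant_on I \<Longrightarrow> l1_norm_on I \<alpha> = (\<Sum>j\<in>I. \<alpha> $ j)"
  unfolding l1_norm_on_def by (intro sum.cong) (auto simp: pos_orthant_on_def)

lemma monomial_on_cong: "(\<And>j. j \<in> I \<Longrightarrow> x $ j = y $ j) \<Longrightarrow> monomial_on I \<alpha> x = monomial_on I \<alpha> y"
  by (simp add: monomial_on_def)

lemma monomial_on_nonneg: "0 \<le> monomial_on I \<alpha> x"
  by (simp add: monomial_on_def prod_nonneg)

lemma monomial_on_pos: "x \<in> pos_orthant_on I \<Longrightarrow> 0 < monomial_on I \<alpha> x"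
  unfolding monomial_on_def pos_orthant_on_def by (intro prod_pos) (auto simp: less_le)

lemma monomial_on_eq_0: "j \<in> I \<Longrightarrow> x $ j = 0 \<Longrightarrow> monomial_on I \<alpha> x = 0"
  unfolding monomial_on_def by (rule prod_zero) auto

lemma monomial_on_eq_exp:
  assumes "x \<in> pos_orthant_on I"
  shows "monomial_on I \<alpha> x = exp (\<Sum>j\<in>I. \<alpha> $ j * ln (x $ j))"
proof -
  have "(x $ j) powr (\<alpha> $ j) = exp (\<alpha> $ j * ln (x $ j))" if "j \<in> I" for j
    using assms that by (auto simp: pos_orthant_on_def powr_def)
  then show ?thesis
    unfolding monomial_on_def by (simp add: exp_sum)
qed

lemma monomial_on_scaleR:
  assumes "\<alpha> \<in> pos_orthant_on I" "x \<in> orthant_on I" "0 < s"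
  shows "monomial_on I \<alpha> (s *\<^sub>R x) = s powr l1_norm_on I \<alpha> * monomial_on I \<alpha> x"
proof -
  have "monomial_on I \<alpha> (s *\<^sub>R x) = (\<Prod>j\<in>I. s powr (\<alpha> $ j) * (x $ j) powr (\<alpha> $ j))"
    unfolding monomial_on_def
    using assms by (intro prod.cong) (auto simp: orthant_on_def powr_mult)
  also have "\<dots> = s powr (\<Sum>j\<in>I. \<alpha> $ j) * monomial_on I \<alpha> x"
    using assms by (simp add: prod.distrib monomial_on_def powr_sum)
  finally show ?thesis
    using assms by (simp add: l1_norm_on_pos_orthant)
qed

lemma continuous_on_monomial_on:
  assumes "\<alpha> \<in> pos_orthant_on I"
  shows "continuous_on (orthant_on I) (monomial_on I \<alpha>)"
  unfolding monomial_on_def using assms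
  by (intro continuous_on_prod continuous_on_powr' continuous_intros)
     (auto simp: orthant_on_def pos_orthant_on_def)

section \<open>Derivatives and linearizations of monomials\<close>

lemma has_derivative_monomial_on:
  assumes a: "a \<in> pos_orthant_on I"
  shows "(monomial_on I \<alpha> has_derivative
           (\<lambda>h. monomial_on I \<alpha> a * (\<Sum>j\<in>I. \<alpha> $ j * (h $ j) / a $ j))) (at a)"
proof -
  have "((\<lambda>x. exp (\<Sum>j\<in>I. \<alpha> $ j * ln (x $ j))) has_derivative
      (\<lambda>h. monomial_on I \<alpha> a * (\<Sum>j\<in>I. \<alpha> $ j * (h $ j) / a $ j))) (at a)"
    unfolding monomial_on_eq_exp[OF a] using a
    by (auto intro!: derivative_eq_intros bounded_linear_imp_has_derivative[OF bounded_linear_vec_nth]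
        sum.cong simp: pos_orthant_on_def field_simps)
  \<comment> \<open>The exponential form is valid only where all coordinates in \<open>I\<close> are
    positive; that set is open, which suffices for the derivative at \<open>a\<close>.\<close>
  then show ?thesis
    by (rule has_derivative_transform_within_open[OF _ open_pos_orthant_on a])
       (simp add: monomial_on_eq_exp)
qed

text \<open>\<open>gradient\<close> is a definite description, so existence and uniqueness are
  needed: the Riesz vector \<open>D\<close> of \<open>f'\<close> is a gradient, and derivatives are
  unique. Afterwards any derivative in functional form can be used.\<close>

lemma linearization_eq:
  fixes f :: "'a::euclidean_space \<Rightarrow> real"
  assumes "(f has_derivative f') (at a)"
  shows "linearization f a x = f a + f' (x - a)"
proof -
  have lin: "linear f'"
    using assms has_derivative_linear by blast
  define D where "D = adjoint f' 1"
  have f': "f' = (\<lambda>h. h \<bullet> D)"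
    using adjoint_works[OF lin, of _ 1] by (auto simp: D_def)
  have "GDERIV f a :> D"
    using assms by (simp add: gderiv_def f' inner_commute)
  moreover have "D' = D" if "GDERIV f a :> D'" for D'
  proof -
    have "(\<lambda>h. h \<bullet> D') = (\<lambda>h. h \<bullet> D)"
      using that assms unfolding gderiv_def f' by (rule has_derivative_unique)
    then show ?thesis
      using vector_eq_rdot[of D' D] by (simp add: fun_eq_iff inner_commute)
  qed
  ultimately have "gradient f a = D"
    unfolding gradient_def by (rule the_equality)
  then show ?thesis
    by (simp add: linearization_def f' inner_commute)
qed

lemma linearization_monomial_on:
  assumes "a \<in> pos_orthant_on I"
  shows "linearization (monomial_on I \<alpha>) a x =
           monomial_on I \<alpha> a * (1 + (\<Sum>j\<in>I. \<alpha> $ j * (x $ j - a $ j) / a $ j))"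
  using linearization_eq[OF has_derivative_monomial_on[OF assms]] by (simp add: distrib_left)

text \<open>Lets the two blocks of coordinates be treated separately although both live in one
  vector.\<close>

lemma linearization_monomial_on_cong:
  assumes "a \<in> pos_orthant_on I" "\<And>j. j \<in> I \<Longrightarrow> a $ j = b $ j" "\<And>j. j \<in> I \<Longrightarrow> x $ j = y $ j"
  shows "linearization (monomial_on I \<alpha>) a x = linearization (monomial_on I \<alpha>) b y"
proof -
  have "b \<in> pos_orthant_on I"
    using assms by (auto simp: pos_orthant_on_def)
  then show ?thesis
    using assms monomial_on_cong[of I a b \<alpha>] by (simp add: linearization_monomial_on)
qed

lemma linearization_self: "linearization f a a = f a"
  by (simp add: linearization_def)

lemma linearization_convex_combination:
  assumes "s + t = 1"
  shows "linearization f a (s *\<^sub>R x + t *\<^sub>R y) = s * linearization f a x + t * linearization f a y"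
proof -
  have s: "s = 1 - t"
    using assms by simp
  show ?thesis
    unfolding linearization_def s by (simp add: inner_diff_right inner_add_right algebra_simps)
qed

lemma continuous_on_linearization: "continuous_on S (linearization f a)"
  unfolding linearization_def by (intro continuous_intros)

text \<open>A monomial of degree 1 has a gradient of degree 0 and, by Euler's identity, no constant
  term in its linearization, so the tangent is the same along the whole ray through
  \<open>a\<close>. This makes it possible to rescale a point of tangency.\<close>

lemma linearization_monomial_on_scaleR:
  assumes "\<alpha> \<in> pos_orthant_on I" "l1_norm_on I \<alpha> = 1" "a \<in> pos_orthant_on I" "0 < s"
  shows "linearization (monomial_on I \<alpha>) (s *\<^sub>R a) x = linearization (monomial_on I \<alpha>) a x"
proof -
  have hom: "linearization (monomial_on I \<alpha>) b x = monomial_on I \<alpha> b * (\<Sum>j\<in>I. \<alpha> $ j * x $ j / b $ j)"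
    if "b \<in> pos_orthant_on I" for b
  proof -
    have "(\<Sum>j\<in>I. \<alpha> $ j * (x $ j - b $ j) / b $ j) = (\<Sum>j\<in>I. \<alpha> $ j * x $ j / b $ j - \<alpha> $ j)"
      using that by (intro sum.cong) (auto simp: pos_orthant_on_def field_simps)
    also have "\<dots> = (\<Sum>j\<in>I. \<alpha> $ j * x $ j / b $ j) - 1"
      using assms l1_norm_on_pos_orthant[of \<alpha> I] by (simp add: sum_subtractf)
    finally show ?thesis
      using that by (simp add: linearization_monomial_on)
  qed
  have "s *\<^sub>R a \<in> pos_orthant_on I"
    using assms by (simp add: pos_orthant_on_def)
  moreover have "monomial_on I \<alpha> (s *\<^sub>R a) = s * monomial_on I \<alpha> a"
    using assms monomial_on_scaleR[of \<alpha> I a s] pos_orthant_on_subset_orthant_on by auto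
  moreover have "(\<Sum>j\<in>I. \<alpha> $ j * x $ j / (s *\<^sub>R a) $ j) = (\<Sum>j\<in>I. \<alpha> $ j * x $ j / a $ j) / s"
    by (simp add: sum_divide_distrib mult.commute)
  ultimately show ?thesis
    using assms by (simp add: hom)
qed

text \<open>The partial derivatives at \<open>a\<close> are nonnegative, so the tangent does not
  increase when coordinates are lowered.\<close>

lemma linearization_monomial_on_le:
  assumes "\<alpha> \<in> pos_orthant_on I" "a \<in> pos_orthant_on I" "\<And>j. j \<in> I \<Longrightarrow> x $ j \<le> a $ j"
  shows "linearization (monomial_on I \<alpha>) a x \<le> monomial_on I \<alpha> a"
proof -
  have "(\<Sum>j\<in>I. \<alpha> $ j * (x $ j - a $ j) / a $ j) \<le> 0"
    using assms by (intro sum_nonpos)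
      (force simp: pos_orthant_on_def intro: divide_nonpos_pos mult_nonneg_nonpos less_imp_le)
  then have "monomial_on I \<alpha> a * (1 + (\<Sum>j\<in>I. \<alpha> $ j * (x $ j - a $ j) / a $ j)) \<le> monomial_on I \<alpha> a * 1"
    by (intro mult_left_mono) (auto simp: monomial_on_nonneg)
  then show ?thesis
    by (simp add: linearization_monomial_on assms)
qed

section \<open>Weighted AM-GM and concavity of monomials\<close>

text \<open>The missing weight \<open>1 - sum w I\<close> is placed on an extra point 1, so that
  \<open>?m\<close> becomes a mean with total weight 1. The tangent of \<open>ln\<close> at
  \<open>?m\<close> then bounds the logarithm of the product, as in Jensen's inequality.\<close>

lemma weighted_am_gm:
  fixes w y :: "'a \<Rightarrow> real"
  assumes "finite I" and w: "\<And>j. j \<in> I \<Longrightarrow> 0 < w j" and w1: "sum w I \<le> 1"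
    and y: "\<And>j. j \<in> I \<Longrightarrow> 0 \<le> y j"
  shows "(\<Prod>j\<in>I. y j powr w j) \<le> 1 + (\<Sum>j\<in>I. w j * (y j - 1))" (is "_ \<le> ?m")
proof -
  have m: "?m = (1 - sum w I) + (\<Sum>j\<in>I. w j * y j)"
    by (simp add: right_diff_distrib sum_subtractf)
  have nn: "0 \<le> (\<Sum>j\<in>I. w j * y j)"
    by (intro sum_nonneg mult_nonneg_nonneg less_imp_le w y)
  show ?thesis
  proof (cases "\<exists>j\<in>I. y j = 0")
    case True
    then have "(\<Prod>j\<in>I. y j powr w j) = 0"
      using \<open>finite I\<close> by (auto intro!: prod_zero)
    then show ?thesis
      using m nn w1 by simp
  next
    case False
    then have y: "\<And>j. j \<in> I \<Longrightarrow> 0 < y j"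
      using y by force
    have m0: "0 < ?m"
    proof (cases "I = {}")
      case False
      then have "0 < (\<Sum>j\<in>I. w j * y j)"
        using \<open>finite I\<close> w y by (intro sum_pos) auto
      then show ?thesis
        using m w1 by linarith
    qed simp
    have "ln (y j) \<le> ln ?m + (y j / ?m - 1)" if "j \<in> I" for j
      using ln_le_minus_one[of "y j / ?m"] y[OF that] m0 by (simp add: ln_div)
    then have "(\<Sum>j\<in>I. w j * ln (y j)) \<le> (\<Sum>j\<in>I. w j * (ln ?m + (y j / ?m - 1)))"
      by (intro sum_mono mult_left_mono) (auto simp: w less_imp_le)
    also have "\<dots> = sum w I * ln ?m + ((\<Sum>j\<in>I. w j * y j) / ?m - sum w I)"
      unfolding distrib_left right_diff_distrib sum.distrib sum_subtractf sum_distrib_right sum_divide_distrib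
      by simp
    also have "(\<Sum>j\<in>I. w j * y j) / ?m - sum w I = (1 - sum w I) * (1 - 1 / ?m)"
    proof -
      have "(\<Sum>j\<in>I. w j * y j) = ?m - (1 - sum w I)"
        using m by simp
      then show ?thesis
        using m0 by (simp add: field_simps)
    qed
    \<comment> \<open>Tangent bound for the extra point 1, which carries the weight
      \<open>1 - sum w I\<close>: \<open>ln (1 / ?m) \<le> 1 / ?m - 1\<close>.\<close>
    also have "\<dots> \<le> (1 - sum w I) * ln ?m"
      using ln_le_minus_one[of "1 / ?m"] m0 w1 by (intro mult_left_mono) (auto simp: ln_div)
    finally have "(\<Sum>j\<in>I. w j * ln (y j)) \<le> ln ?m"
      by (simp add: algebra_simps)
    then have "exp (\<Sum>j\<in>I. w j * ln (y j)) \<le> ?m"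
      using m0 by (simp add: ln_ge_iff)
    moreover have "(\<Prod>j\<in>I. y j powr w j) = exp (\<Sum>j\<in>I. w j * ln (y j))"
      using \<open>finite I\<close> False by (simp add: exp_sum powr_def)
    ultimately show ?thesis
      by simp
  qed
qed

text \<open>Weighted AM-GM for the ratios \<open>x $ j / a $ j\<close>, after factoring out
  \<open>monomial_on I \<alpha> a\<close>.\<close>

lemma monomial_on_le_linearization:
  assumes "\<alpha> \<in> pos_orthant_on I" "l1_norm_on I \<alpha> \<le> 1" "a \<in> pos_orthant_on I" "x \<in> orthant_on I"
  shows "monomial_on I \<alpha> x \<le> linearization (monomial_on I \<alpha>) a x"
proof -
  have eq: "monomial_on I \<alpha> x = monomial_on I \<alpha> a * (\<Prod>j\<in>I. (x $ j / a $ j) powr (\<alpha> $ j))"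
    unfolding monomial_on_def prod.distrib[symmetric]
    using assms by (intro prod.cong) (auto simp: orthant_on_def pos_orthant_on_def powr_divide)
  have "(\<Prod>j\<in>I. (x $ j / a $ j) powr (\<alpha> $ j)) \<le> 1 + (\<Sum>j\<in>I. \<alpha> $ j * (x $ j / a $ j - 1))"
    using assms l1_norm_on_pos_orthant[of \<alpha> I]
    by (intro weighted_am_gm) (auto simp: orthant_on_def pos_orthant_on_def less_imp_le)
  also have "(\<Sum>j\<in>I. \<alpha> $ j * (x $ j / a $ j - 1)) = (\<Sum>j\<in>I. \<alpha> $ j * (x $ j - a $ j) / a $ j)"
    using assms by (intro sum.cong) (auto simp: pos_orthant_on_def field_simps)
  finally show ?thesis
    unfolding eq linearization_monomial_on[OF assms(3)]
    by (intro mult_left_mono monomial_on_nonneg)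
qed

text \<open>The tangent at a positive convex combination lies above the monomial at both end points
  and touches it at the combination.\<close>

lemma concave_on_monomial_on:
  assumes "\<alpha> \<in> pos_orthant_on I" "l1_norm_on I \<alpha> \<le> 1"
  shows "concave_on (orthant_on I) (monomial_on I \<alpha>)"
  unfolding concave_on_iff
proof (intro conjI convex_orthant_on ballI allI impI)
  fix x y :: "real ^ 'a" and s t :: real
  assume x: "x \<in> orthant_on I" and y: "y \<in> orthant_on I" and st: "0 \<le> s" "0 \<le> t" "s + t = 1"
  let ?f = "monomial_on I \<alpha>" and ?z = "s *\<^sub>R x + t *\<^sub>R y"
  show "s * ?f x + t * ?f y \<le> ?f ?z"
  proof (cases "?z \<in> pos_orthant_on I")
    case True
    have "s * ?f x + t * ?f y \<le> s * linearization ?f ?z x + t * linearization ?f ?z y"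
      using assms x y st True by (intro add_mono mult_left_mono monomial_on_le_linearization)
    then show ?thesis
      using linearization_convex_combination[OF st(3), of ?f ?z x y] by (simp add: linearization_self)
  next
    case False
    then obtain j where j: "j \<in> I" "s * x $ j + t * y $ j \<le> 0"
      by (auto simp: pos_orthant_on_def not_less)
    moreover have "0 \<le> s * x $ j" "0 \<le> t * y $ j"
      using x y st j by (auto simp: orthant_on_def)
    ultimately have "s * x $ j = 0" "t * y $ j = 0"
      by linarith+
    then have "s * ?f x = 0" "t * ?f y = 0"
      using monomial_on_eq_0[OF j(1)] by auto
    then show ?thesis
      using monomial_on_nonneg[of I \<alpha> ?z] by linarith
  qed
qed

subsection \<open>Moving along a direction\<close>

lemma eventually_greater_along_direction:
  fixes f :: "'a::real_normed_vector \<Rightarrow> real"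
  assumes "(f has_derivative f') (at p)" "0 < f' d"
  shows "\<forall>\<^sub>F t in at_right 0. f p < f (p + t *\<^sub>R d)"
proof -
  have "((\<lambda>t::real. p + t *\<^sub>R d) has_derivative (\<lambda>t. t *\<^sub>R d)) (at 0)"
    by (auto intro!: derivative_eq_intros)
  then have "((\<lambda>t::real. f (p + t *\<^sub>R d)) has_derivative (\<lambda>t. f' (t *\<^sub>R d))) (at 0)"
    by (rule has_derivative_compose) (use assms in simp)
  moreover have "(\<lambda>t. f' (t *\<^sub>R d)) = (\<lambda>t. f' d * t)"
    using linear_cmul[OF has_derivative_linear[OF assms(1)], of _ d] by (simp add: mult.commute)
  ultimately have "((\<lambda>t::real. f (p + t *\<^sub>R d)) has_real_derivative f' d) (at 0)"
    by (simp add: has_field_derivative_def)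
  from DERIV_pos_inc_right[OF this assms(2)] obtain e where
    "0 < e" "\<And>h. 0 < h \<Longrightarrow> h < e \<Longrightarrow> f p < f (p + h *\<^sub>R d)"
    by auto
  then show ?thesis
    by (auto simp: eventually_at_right_field)
qed

lemma eventually_along_direction_in_open:
  fixes p d :: "'a::real_normed_vector"
  assumes "open U" "p \<in> U"
  shows "\<forall>\<^sub>F t in at_right (0::real). p + t *\<^sub>R d \<in> U"
proof -
  have "((\<lambda>t::real. p + t *\<^sub>R d) \<longlongrightarrow> p + 0 *\<^sub>R d) (at_right 0)"
    by (intro tendsto_intros)
  then show ?thesis
    using assms by (auto dest: topological_tendstoD)
qed

text \<open>\<open>p\<close> lies strictly between \<open>x\<close> and an interior point, with
  weight \<open>1 / (1 + t)\<close> on the latter.\<close>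

lemma interior_if_beyond:
  fixes C :: "'a::euclidean_space set"
  assumes "convex C" "x \<in> C" "0 < t" "p + t *\<^sub>R (p - x) \<in> interior C"
  shows "p \<in> interior C"
proof -
  let ?q = "p + t *\<^sub>R (p - x)"
  have "x - (1 / (1 + t)) *\<^sub>R (x - ?q) = p"
  proof -
    have "x - ?q = - ((1 + t) *\<^sub>R (p - x))"
      by (simp add: algebra_simps)
    then show ?thesis
      using \<open>0 < t\<close> by simp
  qed
  moreover have "x - (1 / (1 + t)) *\<^sub>R (x - ?q) \<in> interior C"
    using assms by (intro mem_interior_convex_shrink) auto
  ultimately show ?thesis
    by simp
qed

subsection \<open>The set \<open>\<C>\<close>\<close>

lemma has_derivative_linearization:
  fixes f :: "'a::euclidean_space \<Rightarrow> real"
  assumes "(f has_derivative f') (at a)"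
  shows "(linearization f a has_derivative f') (at p)"
proof -
  have "linearization f a = (\<lambda>x. f a + (f' x - f' a))"
    using linearization_eq[OF assms] linear_diff[OF has_derivative_linear[OF assms]] by auto
  moreover have "(f' has_derivative f') (at p)"
    using assms by (intro bounded_linear_imp_has_derivative has_derivative_bounded_linear)
  ultimately show ?thesis
    by (auto intro!: derivative_eq_intros)
qed

text \<open>An affine function is its own tangent everywhere. Hence the function defining
  \<open>C_st\<close> can be linearized at a new point without changing its affine part.\<close>

lemma linearization_linearization:
  fixes f :: "'a::euclidean_space \<Rightarrow> real"
  assumes "(f has_derivative f') (at a)"
  shows "linearization (linearization f a) p = linearization f a"
proof
  fix x
  have "f' (x - p) = f' (x - a) - f' (p - a)"
    using linear_diff[OF has_derivative_linear[OF assms], of "x - a" "p - a"] by simp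
  then show "linearization (linearization f a) p x = linearization f a x"
    by (simp add: linearization_eq[OF has_derivative_linearization[OF assms]] linearization_eq[OF assms])
qed

lemma has_derivative_C_st_function:
  fixes H K :: "'n::finite set"
  assumes "p \<in> pos_orthant_on H" "vt \<in> pos_orthant_on K"
  shows "((\<lambda>x. monomial_on H \<beta> x - linearization (monomial_on K \<gamma>) vt x) has_derivative
           (\<lambda>h. monomial_on H \<beta> p * (\<Sum>j\<in>H. \<beta> $ j * h $ j / p $ j)
              - monomial_on K \<gamma> vt * (\<Sum>j\<in>K. \<gamma> $ j * h $ j / vt $ j))) (at p)"
  by (intro has_derivative_diff has_derivative_monomial_on has_derivative_linearization assms)

section \<open>Freeness of \<open>C_st\<close>\<close>

lemma S_st_psubset:
  fixes H K :: "'n::finite set"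
  assumes "H \<inter> K = {}" "H \<union> K = UNIV" "\<beta> \<in> pos_orthant_on H"
  shows "S_st H K \<beta> \<gamma> \<subset> orthant_on UNIV"
proof -
  \<comment> \<open>For nonempty \<open>K\<close> the zeros make the monomial in \<open>v\<close>
    vanish. For empty \<open>K\<close> it is the empty product 1, which is why the entries in
    \<open>H\<close> exceed 1.\<close>
  define x :: "real ^ 'n" where "x = (\<chi> j. if j \<in> H then 2 else 0)"
  have x: "x \<in> orthant_on UNIV"
    by (simp add: x_def orthant_on_def)
  have "monomial_on H \<beta> x = monomial_on H \<beta> (2 *\<^sub>R 1)"
    by (intro monomial_on_cong) (simp add: x_def)
  also have "\<dots> = 2 powr l1_norm_on H \<beta>"
    using assms by (subst monomial_on_scaleR) (auto simp: orthant_on_def monomial_on_def)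
  finally have \<psi>: "monomial_on H \<beta> x = 2 powr l1_norm_on H \<beta>" .
  have "monomial_on K \<gamma> x < monomial_on H \<beta> x"
  proof (cases "K = {}")
    case True
    then have "0 < l1_norm_on H \<beta>"
      unfolding l1_norm_on_pos_orthant[OF assms(3)]
      using assms by (intro sum_pos) (auto simp: pos_orthant_on_def)
    moreover have "monomial_on K \<gamma> x = 1"
      using True by (simp add: monomial_on_def)
    ultimately show ?thesis
      by (simp add: \<psi>)
  next
    case False
    then obtain j where "j \<in> K" by auto
    then have "monomial_on K \<gamma> x = 0"
      using assms by (intro monomial_on_eq_0) (auto simp: x_def)
    then show ?thesis
      by (simp add: \<psi>)
  qed
  then have "x \<notin> S_st H K \<beta> \<gamma>"
    by (simp add: S_st_def)
  then show ?thesis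
    using x by (auto simp: S_st_def)
qed

lemma closed_C_st:
  fixes H K :: "'n::finite set"
  assumes "\<beta> \<in> pos_orthant_on H"
  shows "closed (C_st H K \<beta> \<gamma> vt)"
proof -
  have "continuous_on (orthant_on H) (\<lambda>x. monomial_on H \<beta> x - linearization (monomial_on K \<gamma>) vt x)"
    using assms by (intro continuous_on_diff continuous_on_monomial_on continuous_on_linearization)
  from continuous_closed_preimage[OF this closed_orthant_on closed_atLeast, of 0]
  show ?thesis
    by (simp add: C_st_def vimage_def Int_def)
qed

lemma convex_C_st:
  fixes H K :: "'n::finite set"
  assumes "\<beta> \<in> pos_orthant_on H" "l1_norm_on H \<beta> \<le> 1"
  shows "convex (C_st H K \<beta> \<gamma> vt)"
  unfolding convex_def
proof (intro ballI allI impI)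
  fix x y :: "real ^ 'n" and s t :: real
  let ?f = "monomial_on H \<beta>" and ?l = "linearization (monomial_on K \<gamma>) vt"
  let ?z = "s *\<^sub>R x + t *\<^sub>R y"
  assume xy: "x \<in> C_st H K \<beta> \<gamma> vt" "y \<in> C_st H K \<beta> \<gamma> vt" and st: "0 \<le> s" "0 \<le> t" "s + t = 1"
  then have x: "x \<in> orthant_on H" "?l x \<le> ?f x" and y: "y \<in> orthant_on H" "?l y \<le> ?f y"
    by (auto simp: C_st_def)
  have "?l ?z = s * ?l x + t * ?l y"
    by (rule linearization_convex_combination[OF st(3)])
  also have "\<dots> \<le> s * ?f x + t * ?f y"
    using x y st by (intro add_mono mult_left_mono)
  also have "\<dots> \<le> ?f ?z"
    using concave_on_monomial_on[OF assms] x y st by (simp add: concave_on_iff)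
  finally show "?z \<in> C_st H K \<beta> \<gamma> vt"
    using x y st convexD[OF convex_orthant_on] by (simp add: C_st_def)
qed

lemma interior_C_st_disjoint:
  fixes H K :: "'n::finite set"
  assumes HK: "H \<inter> K = {}" "H \<union> K = UNIV"
    and \<beta>: "\<beta> \<in> pos_orthant_on H"
    and \<gamma>: "\<gamma> \<in> pos_orthant_on K" "l1_norm_on K \<gamma> \<le> 1"
    and vt: "vt \<in> pos_orthant_on K"
  shows "interior (C_st H K \<beta> \<gamma> vt) \<inter> S_st H K \<beta> \<gamma> = {}"
proof (rule ccontr)
  assume "interior (C_st H K \<beta> \<gamma> vt) \<inter> S_st H K \<beta> \<gamma> \<noteq> {}"
  then obtain x where xI: "x \<in> interior (C_st H K \<beta> \<gamma> vt)" and xS: "x \<in> S_st H K \<beta> \<gamma>"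
    by auto
  let ?g = "\<lambda>x. monomial_on H \<beta> x - linearization (monomial_on K \<gamma>) vt x"
  \<comment> \<open>Opposite in sign to the partial derivatives of \<open>?g\<close>, which are
    positive on \<open>H\<close> (at positive points) and negative on \<open>K\<close>.\<close>
  define d :: "real ^ 'n" where "d = (\<chi> j. if j \<in> H then -1 else 1)"
  have inC: "\<forall>\<^sub>F t in at_right (0::real). x + t *\<^sub>R d \<in> interior (C_st H K \<beta> \<gamma> vt)"
    using xI by (intro eventually_along_direction_in_open) auto
  \<comment> \<open>The set still contains the point after its coordinates in \<open>H\<close> are
    lowered by some \<open>t > 0\<close>, so these are at least \<open>t\<close>. This makes
    \<open>?g\<close> differentiable at \<open>x\<close>.\<close>
  have xpos: "x \<in> pos_orthant_on H"
  proof -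
    have "\<forall>\<^sub>F t in at_right (0::real). 0 < t \<and> x + t *\<^sub>R d \<in> interior (C_st H K \<beta> \<gamma> vt)"
      using inC eventually_at_right_less[of "0::real"] by eventually_elim simp
    from eventually_happens'[OF trivial_limit_at_right_real this] obtain t :: real where
      "0 < t" "x + t *\<^sub>R d \<in> C_st H K \<beta> \<gamma> vt"
      using interior_subset by (auto simp: subset_iff)
    then have "0 < t" "\<forall>j\<in>H. t \<le> x $ j"
      by (auto simp: C_st_def orthant_on_def d_def)
    then show ?thesis
      by (fastforce simp: pos_orthant_on_def)
  qed
  have "?g x \<le> 0"
  proof -
    have "monomial_on K \<gamma> x \<le> linearization (monomial_on K \<gamma>) vt x"
      using \<gamma> vt xS by (intro monomial_on_le_linearization) (auto simp: S_st_def orthant_on_def)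
    then show ?thesis
      using xS by (simp add: S_st_def)
  qed
  have "\<forall>\<^sub>F t in at_right 0. - ?g x < - ?g (x + t *\<^sub>R d)"
  proof (rule eventually_greater_along_direction)
    show "((\<lambda>x. - ?g x) has_derivative
           (\<lambda>h. - (monomial_on H \<beta> x * (\<Sum>j\<in>H. \<beta> $ j * h $ j / x $ j)
              - monomial_on K \<gamma> vt * (\<Sum>j\<in>K. \<gamma> $ j * h $ j / vt $ j)))) (at x)"
      by (intro has_derivative_minus has_derivative_C_st_function xpos vt)
    have dH: "(\<Sum>j\<in>H. \<beta> $ j * d $ j / x $ j) = - (\<Sum>j\<in>H. \<beta> $ j / x $ j)"
      by (simp add: d_def sum_negf)
    have dK: "(\<Sum>j\<in>K. \<gamma> $ j * d $ j / vt $ j) = (\<Sum>j\<in>K. \<gamma> $ j / vt $ j)"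
      using HK by (intro sum.cong) (auto simp: d_def)
    have pH: "0 < (\<Sum>j\<in>H. \<beta> $ j / x $ j)" if "H \<noteq> {}"
      using that \<beta> xpos by (intro sum_pos) (auto simp: pos_orthant_on_def)
    have pK: "0 < (\<Sum>j\<in>K. \<gamma> $ j / vt $ j)" if "K \<noteq> {}"
      using that \<gamma> vt by (intro sum_pos) (auto simp: pos_orthant_on_def)
    \<comment> \<open>One block may be empty but not both, so at least one of the two sums is
      strictly positive.\<close>
    have "H \<noteq> {} \<or> K \<noteq> {}"
      using HK by auto
    moreover have "0 < monomial_on H \<beta> x" "0 < monomial_on K \<gamma> vt"
      using xpos vt by (auto intro: monomial_on_pos)
    ultimately have "0 < monomial_on H \<beta> x * (\<Sum>j\<in>H. \<beta> $ j / x $ j)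
        + monomial_on K \<gamma> vt * (\<Sum>j\<in>K. \<gamma> $ j / vt $ j)"
      using pH pK by (cases "H = {}"; cases "K = {}") (auto intro: add_pos_pos)
    then show "0 < - (monomial_on H \<beta> x * (\<Sum>j\<in>H. \<beta> $ j * d $ j / x $ j)
              - monomial_on K \<gamma> vt * (\<Sum>j\<in>K. \<gamma> $ j * d $ j / vt $ j))"
      by (simp add: dH dK)
  qed
  with inC have "\<forall>\<^sub>F t in at_right 0.
      x + t *\<^sub>R d \<in> interior (C_st H K \<beta> \<gamma> vt) \<and> - ?g x < - ?g (x + t *\<^sub>R d)"
    by (rule eventually_conj)
  from eventually_happens'[OF trivial_limit_at_right_real this] obtain t where
    "x + t *\<^sub>R d \<in> C_st H K \<beta> \<gamma> vt" "?g (x + t *\<^sub>R d) < ?g x"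
    using interior_subset by force
  then show False
    using \<open>?g x \<le> 0\<close> by (simp add: C_st_def)
qed

section \<open>Maximality of \<open>C_st\<close>\<close>

text \<open>The \<open>H\<close>-block of \<open>p\<close> is taken on the ray of a slightly shifted
  \<open>x\<close>, the \<open>K\<close>-block on the ray of \<open>vt\<close>. Rescaling the block
  whose monomial has degree 1 equalizes the two monomials and leaves both tangents
  unchanged.\<close>

lemma separating_tangent_point:
  fixes H K :: "'n::finite set"
  assumes HK: "H \<inter> K = {}" "H \<union> K = UNIV"
    and \<beta>: "\<beta> \<in> pos_orthant_on H" and \<gamma>: "\<gamma> \<in> pos_orthant_on K"
    and max1: "l1_norm_on H \<beta> = 1 \<or> l1_norm_on K \<gamma> = 1"
    and vt: "vt \<in> pos_orthant_on K"
    and x: "x \<in> orthant_on UNIV"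
    and neg: "monomial_on H \<beta> x < linearization (monomial_on K \<gamma>) vt x"
  obtains p where "p \<in> pos_orthant_on UNIV" "monomial_on H \<beta> p = monomial_on K \<gamma> p"
    "linearization (monomial_on K \<gamma>) vt p = monomial_on K \<gamma> p"
    "linearization (monomial_on H \<beta>) p x < linearization (monomial_on K \<gamma>) vt x"
proof -
  let ?l = "linearization (monomial_on K \<gamma>) vt"
  \<comment> \<open>\<open>x\<close> may have zero coordinates, where a tangent can fail to exist,
    so it is shifted into the positive orthant; continuity preserves the strict inequality
    \<open>neg\<close> for small shifts.\<close>
  have cont: "continuous_on {0::real..} (\<lambda>e. monomial_on H \<beta> (x + e *\<^sub>R 1))"
    using x by (intro continuous_on_compose2[OF continuous_on_monomial_on[OF \<beta>]] continuous_intros)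
      (auto simp: orthant_on_def)
  have "((\<lambda>e. monomial_on H \<beta> (x + e *\<^sub>R 1)) \<longlongrightarrow> monomial_on H \<beta> x) (at_right (0::real))"
    using bspec[OF cont[unfolded continuous_on_def], of 0] by (simp add: at_within_Ici_at_right)
  then have "\<forall>\<^sub>F e in at_right (0::real). monomial_on H \<beta> (x + e *\<^sub>R 1) < ?l x"
    using neg by (rule order_tendstoD(2))
  then have "\<forall>\<^sub>F e in at_right (0::real). 0 < e \<and> monomial_on H \<beta> (x + e *\<^sub>R 1) < ?l x"
    using eventually_at_right_less[of "0::real"] by eventually_elim simp
  from eventually_happens'[OF trivial_limit_at_right_real this] obtain e :: real where
    e: "0 < e" "monomial_on H \<beta> (x + e *\<^sub>R 1) < ?l x"
    by auto
  define u where "u = x + e *\<^sub>R 1"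
  have u: "u \<in> pos_orthant_on UNIV" "\<And>j. x $ j \<le> u $ j"
    using x e by (auto simp: u_def pos_orthant_on_def orthant_on_def add_nonneg_pos)
  then have uH: "u \<in> pos_orthant_on H"
    by (simp add: pos_orthant_on_def)
  \<comment> \<open>\<open>u\<close> dominates \<open>x\<close>, so the tangent at \<open>u\<close>,
    evaluated back at \<open>x\<close>, stays below the value at \<open>u\<close>.\<close>
  have lin_u: "linearization (monomial_on H \<beta>) u x < ?l x"
    using linearization_monomial_on_le[OF \<beta> uH u(2)] e(2) by (simp add: u_def)
  define A where "A = monomial_on H \<beta> u"
  define B where "B = monomial_on K \<gamma> vt"
  have AB: "0 < A" "0 < B"
    using uH vt by (auto simp: A_def B_def monomial_on_pos)
  \<comment> \<open>Only one block is rescaled: if \<open>\<gamma>\<close> has norm 1, then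
    \<open>r * B = A\<close>; otherwise \<open>max1\<close> gives norm 1 for \<open>\<beta>\<close>,
    and \<open>s * A = B\<close>. The other factor is 1, so its exponent does not matter.\<close>
  define s where "s = (if l1_norm_on K \<gamma> = 1 then 1 else B / A)"
  define r where "r = (if l1_norm_on K \<gamma> = 1 then A / B else 1)"
  have sr: "0 < s" "0 < r"
    using AB by (auto simp: s_def r_def)
  define p where "p = (\<chi> j. if j \<in> H then s * u $ j else r * vt $ j)"
  have pH: "p $ j = (s *\<^sub>R u) $ j" if "j \<in> H" for j
    using that by (simp add: p_def)
  have pK: "p $ j = (r *\<^sub>R vt) $ j" if "j \<in> K" for j
    using that HK by (auto simp: p_def)
  have p: "p \<in> pos_orthant_on UNIV"
    using HK u vt sr by (auto simp: p_def pos_orthant_on_def)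
  then have p': "p \<in> pos_orthant_on H" "p \<in> pos_orthant_on K"
    by (auto simp: pos_orthant_on_def)
  have "monomial_on H \<beta> p = s powr l1_norm_on H \<beta> * A"
    using monomial_on_cong[OF pH] monomial_on_scaleR[OF \<beta> _ sr(1)] uH
      pos_orthant_on_subset_orthant_on by (force simp: A_def)
  moreover have "monomial_on K \<gamma> p = r powr l1_norm_on K \<gamma> * B"
    using monomial_on_cong[OF pK] monomial_on_scaleR[OF \<gamma> _ sr(2)] vt
      pos_orthant_on_subset_orthant_on by (force simp: B_def)
  ultimately have eq: "monomial_on H \<beta> p = monomial_on K \<gamma> p"
    using max1 AB by (auto simp: s_def r_def)
  have linH: "linearization (monomial_on H \<beta>) p x = linearization (monomial_on H \<beta>) u x"
  proof -
    have "linearization (monomial_on H \<beta>) p x = linearization (monomial_on H \<beta>) (s *\<^sub>R u) x"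
      by (rule linearization_monomial_on_cong[OF p'(1) pH refl])
    also have "\<dots> = linearization (monomial_on H \<beta>) u x"
    proof (cases "l1_norm_on K \<gamma> = 1")
      case False
      then show ?thesis
        using max1 by (intro linearization_monomial_on_scaleR \<beta> uH sr) simp
    qed (simp add: s_def)
    finally show ?thesis .
  qed
  \<comment> \<open>The tangent at \<open>vt\<close> is also the tangent at \<open>p\<close>: the
    \<open>K\<close>-block of \<open>p\<close> is \<open>r\<close> times that of \<open>vt\<close>,
    and either the degree is 1 or \<open>r = 1\<close>.\<close>
  have linK: "?l p = monomial_on K \<gamma> p"
  proof -
    have "?l p = linearization (monomial_on K \<gamma>) (r *\<^sub>R vt) p"
    proof (cases "l1_norm_on K \<gamma> = 1")
      case True
      then show ?thesis
        by (intro linearization_monomial_on_scaleR[symmetric] \<gamma> vt sr)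
    qed (simp add: r_def)
    also have "\<dots> = linearization (monomial_on K \<gamma>) p p"
      by (rule linearization_monomial_on_cong[OF p'(2) pK refl, symmetric])
    finally show ?thesis
      by (simp add: linearization_self)
  qed
  show ?thesis
    using that[OF p eq linK] lin_u linH by simp
qed

lemma C_st_maximal:
  fixes H K :: "'n::finite set"
  assumes HK: "H \<inter> K = {}" "H \<union> K = UNIV"
    and \<beta>: "\<beta> \<in> pos_orthant_on H" and \<gamma>: "\<gamma> \<in> pos_orthant_on K"
    and max1: "l1_norm_on H \<beta> = 1 \<or> l1_norm_on K \<gamma> = 1"
    and vt: "vt \<in> pos_orthant_on K"
    and free: "S_free (S_st H K \<beta> \<gamma>) C'"
    and sub: "C_st H K \<beta> \<gamma> vt \<inter> orthant_on UNIV \<subseteq> C'"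
  shows "C' \<inter> orthant_on UNIV \<subseteq> C_st H K \<beta> \<gamma> vt"
proof
  fix x assume "x \<in> C' \<inter> orthant_on UNIV"
  then have xC': "x \<in> C'" and x: "x \<in> orthant_on UNIV"
    by auto
  let ?l = "linearization (monomial_on K \<gamma>) vt"
  let ?g = "\<lambda>x. monomial_on H \<beta> x - ?l x"
  show "x \<in> C_st H K \<beta> \<gamma> vt"
  proof (rule ccontr)
    assume "x \<notin> C_st H K \<beta> \<gamma> vt"
    then have "monomial_on H \<beta> x < ?l x"
      using x by (auto simp: C_st_def orthant_on_def)
    from separating_tangent_point[OF HK \<beta> \<gamma> max1 vt x this] obtain p where
      p: "p \<in> pos_orthant_on UNIV" and eq: "monomial_on H \<beta> p = monomial_on K \<gamma> p"
      and linK: "?l p = monomial_on K \<gamma> p"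
      and sep: "linearization (monomial_on H \<beta>) p x < ?l x" .
    have pH: "p \<in> pos_orthant_on H"
      using p by (simp add: pos_orthant_on_def)
    let ?g' = "\<lambda>h. monomial_on H \<beta> p * (\<Sum>j\<in>H. \<beta> $ j * h $ j / p $ j)
              - monomial_on K \<gamma> vt * (\<Sum>j\<in>K. \<gamma> $ j * h $ j / vt $ j)"
    have g': "(?g has_derivative ?g') (at p)"
      by (rule has_derivative_C_st_function[OF pH vt])
    \<comment> \<open>The affine part is its own tangent, so \<open>sep\<close> says that the
      tangent of \<open>?g\<close> at \<open>p\<close> is negative at \<open>x\<close>. Since
      \<open>?g p = 0\<close>, that value is the derivative in direction \<open>x - p\<close>, and
      the opposite direction has positive slope.\<close>
    have "linearization ?g p x = linearization (monomial_on H \<beta>) p x - ?l x"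
      using linearization_eq[OF g', of x] linearization_eq[OF has_derivative_monomial_on[OF pH], of \<beta> x]
        linearization_eq[OF has_derivative_linearization[OF has_derivative_monomial_on[OF vt]], of \<gamma> p x]
      by (simp add: linearization_linearization[OF has_derivative_monomial_on[OF vt]])
    then have "?g' (x - p) < 0"
      using sep eq linK linearization_eq[OF g', of x] by simp
    then have "0 < ?g' (p - x)"
      using linear_neg[OF has_derivative_linear[OF g'], of "p - x"] by simp
    from eventually_greater_along_direction[OF g' this]
    have "\<forall>\<^sub>F t in at_right 0. 0 < ?g (p + t *\<^sub>R (p - x))"
      using eq linK by simp
    moreover have "\<forall>\<^sub>F t in at_right (0::real). p + t *\<^sub>R (p - x) \<in> pos_orthant_on UNIV"
      using p by (intro eventually_along_direction_in_open open_pos_orthant_on)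
    ultimately have "\<forall>\<^sub>F t in at_right (0::real). 0 < t \<and> 0 < ?g (p + t *\<^sub>R (p - x)) \<and>
        p + t *\<^sub>R (p - x) \<in> pos_orthant_on UNIV"
      using eventually_at_right_less[of "0::real"] by eventually_elim simp
    from eventually_happens'[OF trivial_limit_at_right_real this] obtain t :: real where
      t: "0 < t" "0 < ?g (p + t *\<^sub>R (p - x))" "p + t *\<^sub>R (p - x) \<in> pos_orthant_on UNIV"
      by auto
    \<comment> \<open>An open neighbourhood of the point beyond \<open>p\<close>; staying in the
      positive orthant keeps it inside the part of \<open>C_st\<close> that \<open>C'\<close>
      contains by \<open>sub\<close>.\<close>
    let ?U = "pos_orthant_on UNIV \<inter> ?g -` {0<..}"
    have "continuous_on (pos_orthant_on UNIV) ?g"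
      by (intro continuous_on_diff continuous_on_linearization
          continuous_on_subset[OF continuous_on_monomial_on[OF \<beta>]])
         (auto simp: pos_orthant_on_def orthant_on_def less_imp_le)
    then have "open ?U"
      by (intro continuous_open_preimage open_pos_orthant_on) auto
    moreover have "?U \<subseteq> C'"
      using sub by (force simp: C_st_def pos_orthant_on_def orthant_on_def intro: less_imp_le)
    ultimately have "?U \<subseteq> interior C'"
      by (rule interior_maximal[rotated])
    then have "p + t *\<^sub>R (p - x) \<in> interior C'"
      using t by blast
    moreover have "convex C'"
      using free by (simp add: S_free_def)
    ultimately have "p \<in> interior C'"
      using interior_if_beyond xC' t(1) by blast
    moreover have "p \<in> S_st H K \<beta> \<gamma>"
      using p eq pos_orthant_on_subset_orthant_on by (auto simp: S_st_def)
    ultimately show False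
      using free by (auto simp: S_free_def)
  qed
qed

theorem proposition1:
  fixes H K :: "'n::finite set" and \<beta> \<gamma> vt :: "real ^ 'n"
  assumes "H \<inter> K = {}" and "H \<union> K = UNIV"
    and "\<beta> \<in> pos_orthant_on H" and "\<gamma> \<in> pos_orthant_on K"
    and "max (l1_norm_on H \<beta>) (l1_norm_on K \<gamma>) \<le> 1"
    and "vt \<in> pos_orthant_on K"
  shows "S_free (S_st H K \<beta> \<gamma>) (C_st H K \<beta> \<gamma> vt)
    \<and> (max (l1_norm_on H \<beta>) (l1_norm_on K \<gamma>) = 1 \<longrightarrow>
         maximal_S_free_in (S_st H K \<beta> \<gamma>) (orthant_on UNIV) (C_st H K \<beta> \<gamma> vt))"
proof (intro conjI impI)
  have psub: "S_st H K \<beta> \<gamma> \<subset> orthant_on UNIV"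
    using assms by (intro S_st_psubset)
  show free: "S_free (S_st H K \<beta> \<gamma>) (C_st H K \<beta> \<gamma> vt)"
    unfolding S_free_def
    using assms psub by (intro conjI closed_C_st convex_C_st interior_C_st_disjoint) auto
  assume "max (l1_norm_on H \<beta>) (l1_norm_on K \<gamma>) = 1"
  then have max1: "l1_norm_on H \<beta> = 1 \<or> l1_norm_on K \<gamma> = 1"
    by (auto simp: max_def split: if_splits)
  have "\<not> C_st H K \<beta> \<gamma> vt \<inter> orthant_on UNIV \<subset> C' \<inter> orthant_on UNIV"
    if "S_free (S_st H K \<beta> \<gamma>) C'" for C'
    using C_st_maximal[OF assms(1-4) max1 assms(6) that] by blast
  then show "maximal_S_free_in (S_st H K \<beta> \<gamma>) (orthant_on UNIV) (C_st H K \<beta> \<gamma> vt)"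
    unfolding maximal_S_free_in_def
    using free psub closed_orthant_on convex_orthant_on by blast
qed

end
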